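(* If $\mathcal M$ is a matroid of co-rank $3$ (i.e. its dual $\mathcal M^*$ has rank $3$), then the combinatorial derived matroid $\delta\mathcal M$ is an adjoint of $\mathcal M$.
   Context: Let $E$ be the ground set, $n=|E|$, $d=\mathrm{rank}(\mathcal M)$, $\mathcal C(\mathcal M)$ the set of circuits. Define $\mathcal S(\mathcal M)=\{\mathcal S\subseteq\mathcal C(\mathcal M): |\mathcal S|\le (n-d)-r_{\mathcal M^*}(\bigcap_{C\in\mathcal S}(E\setminus C))\}$ (empty intersection $=E$). For a collection $\mathfrak A$ of subsets of $\mathcal C(\mathcal M)$ let $\epsilon(\mathfrak A)=\mathfrak A\cup\{(\mathcal A_1\cup\mathcal A_2)\setminus\{C\}: \mathcal A_1,\mathcal A_2\in\mathfrak A,\ \mathcal A_1\cap\mathcal A_2\notin\mathfrak A,\ C\in\mathcal A_1\cap\mathcal A_2\}$ and $\uparrow\mathfrak A=\{\mathcal A\subseteq\mathcal C(\mathcal M):\exists\mathcal A'\in\mathfrak A,\ \mathcal A'\subseteq\mathcal A\}$. Set $\mathfrak A_0=\mathfrak A$, $\mathfrak A_{i+1}=\uparrow\epsilon(\mathfrak A_i)$ and $D(\mathfrak A)=\bigcup_{i\ge0}\mathfrak A_i$. It is known that if $\emptyset\notin\mathfrak A$ then $D(\mathfrak A)$ is the family of dependent sets of a matroid on $\mathcal C(\mathcal M)$. The combinatorial derived matroid $\delta\mathcal M$ is the matroid on $\mathcal C(\mathcal M)$ whose family of dependent sets is $D(2^{\mathcal C(\mathcal M)}\setminus\mathcal S(\mathcal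 M))$. Adjoint: $\mathcal L^*$ is the lattice of flats of $\mathcal M^*$, $(\mathcal L^* )^{opp}$ its order dual (rank function $(n-d)-r_{\mathcal M^*}$), whose atoms are the hyperplanes $E\setminus C$ of $\mathcal M^*$, $C\in\mathcal C(\mathcal M)$. A matroid $\mathcal N$ on $\mathcal C(\mathcal M)$ with lattice of flats $\mathcal L(\mathcal N)$ is an adjoint of $\mathcal M$ if the map $E\setminus C\mapsto\mathrm{cl}_{\mathcal N}(\{C\})$ is a bijection from the atoms of $(\mathcal L^* )^{opp}$ onto the atoms of $\mathcal L(\mathcal N)$ and extends to a rank-preserving order embedding $f:(\mathcal L^* )^{opp}\to\mathcal L(\mathcal N)$ ($x\le y\iff f(x)\le f(y)$, ranks preserved). *)

theory Defs
  imports "HOL-Algebra.Lattice"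
begin

section \<open>Finite matroids\<close>

record 'a matroid =
  ground :: "'a set"
  indep :: "'a set \<Rightarrow> bool"

locale matroid =
  fixes M :: "'a matroid"
  assumes finite_ground: "finite (ground M)"
    and indep_subset_ground: "indep M X \<Longrightarrow> X \<subseteq> ground M"
    and indep_empty: "indep M {}"
    and indep_subset: "indep M X \<Longrightarrow> Y \<subseteq> X \<Longrightarrow> indep M Y"
    and indep_augment: "indep M X \<Longrightarrow> indep M Y \<Longrightarrow> card X < card Y
      \<Longrightarrow> \<exists>y \<in> Y - X. indep M (insert y X)"

definition rk :: "'a matroid \<Rightarrow> 'a set \<Rightarrow> nat" where
  "rk M X = Max (card ` {I. indep M I \<and> I \<subseteq> X})"

definition basis :: "'a matroid \<Rightarrow> 'a set \<Rightarrow> bool" where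
  "basis M B \<longleftrightarrow> indep M B \<and> (\<forall>I. indep M I \<longrightarrow> B \<subseteq> I \<longrightarrow> I = B)"

definition circuits :: "'a matroid \<Rightarrow> 'a set set" where
  "circuits M = {C. C \<subseteq> ground M \<and> \<not> indep M C \<and> (\<forall>D. D \<subset> C \<longrightarrow> indep M D)}"

definition closure :: "'a matroid \<Rightarrow> 'a set \<Rightarrow> 'a set" where
  "closure M X = {x \<in> ground M. rk M (insert x X) = rk M X}"

definition flats :: "'a matroid \<Rightarrow> 'a set set" where
  "flats M = {F. F \<subseteq> ground M \<and> closure M F = F}"

definition dual :: "'a matroid \<Rightarrow> 'a matroid" where
  "dual M = \<lparr>ground = ground M, indep = (\<lambda>X. \<exists>B. basis M B \<and> X \<subseteq> ground M - B)\<rparr>"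


section \<open>The combinatorial derived matroid\<close>

text \<open>Since \<open>r\<^sub>M\<^sub>* \<le> n - d\<close> and \<open>d \<le> n\<close> for a matroid, the natural-number subtractions
  below never truncate. The intersection with the ground set makes the empty intersection equal
  to the ground set and has no effect on non-empty ones.\<close>

definition small_circuit_sets :: "'a matroid \<Rightarrow> 'a set set set" where
  "small_circuit_sets M = {S. S \<subseteq> circuits M \<and>
     card S \<le> (card (ground M) - rk M (ground M))
       - rk (dual M) (ground M \<inter> (\<Inter>C\<in>S. ground M - C))}"

definition eps_closure :: "'b set set \<Rightarrow> 'b set set" where
  "eps_closure \<AA> = \<AA> \<union> {(A1 \<union> A2) - {C} | A1 A2 C.
     A1 \<in> \<AA> \<and> A2 \<in> \<AA> \<and> A1 \<inter> A2 \<notin> \<AA> \<and> C \<in> A1 \<inter> A2}"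

definition up_closure :: "'b set \<Rightarrow> 'b set set \<Rightarrow> 'b set set" where
  "up_closure K \<AA> = {A. A \<subseteq> K \<and> (\<exists>A' \<in> \<AA>. A' \<subseteq> A)}"

definition dependent_hull :: "'b set \<Rightarrow> 'b set set \<Rightarrow> 'b set set" where
  "dependent_hull K \<AA> = (\<Union>i. ((\<lambda>\<BB>. up_closure K (eps_closure \<BB>)) ^^ i) \<AA>)"

definition derived_matroid :: "'a matroid \<Rightarrow> 'a set matroid" where
  "derived_matroid M = \<lparr>ground = circuits M,
     indep = (\<lambda>X. X \<subseteq> circuits M \<and>
       X \<notin> dependent_hull (circuits M) (Pow (circuits M) - small_circuit_sets M))\<rparr>"


section \<open>Adjoints\<close>

definition flat_lattice :: "'a matroid \<Rightarrow> 'a set gorder" where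
  "flat_lattice M = \<lparr>carrier = flats M, eq = (=), le = (\<subseteq>)\<rparr>"

definition atoms :: "'a gorder \<Rightarrow> 'a set" where
  "atoms L = {a \<in> carrier L. \<bottom>\<^bsub>L\<^esub> \<sqsubset>\<^bsub>L\<^esub> a \<and>
     \<not> (\<exists>x \<in> carrier L. \<bottom>\<^bsub>L\<^esub> \<sqsubset>\<^bsub>L\<^esub> x \<and> x \<sqsubset>\<^bsub>L\<^esub> a)}"

definition dual_flat_lattice_opp :: "'a matroid \<Rightarrow> 'a set gorder" where
  "dual_flat_lattice_opp M = inv_gorder (flat_lattice (dual M))"

text \<open>An atom \<open>H\<close> of the opposite lattice is the complement \<open>ground M - C\<close> of a unique circuit
  \<open>C\<close>, namely \<open>C = ground M - H\<close>; thus the bijection below sends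
  \<open>ground M - C\<close> to \<open>closure N {C}\<close>.\<close>

definition is_adjoint :: "'a matroid \<Rightarrow> 'a set matroid \<Rightarrow> bool" where
  "is_adjoint M N \<longleftrightarrow>
     matroid N \<and> ground N = circuits M \<and>
     bij_betw (\<lambda>H. closure N {ground M - H})
       (atoms (dual_flat_lattice_opp M)) (atoms (flat_lattice N)) \<and>
     (\<exists>f.
        (\<forall>H \<in> atoms (dual_flat_lattice_opp M). f H = closure N {ground M - H}) \<and>
        f \<in> carrier (dual_flat_lattice_opp M) \<rightarrow> carrier (flat_lattice N) \<and>
        (\<forall>x \<in> carrier (dual_flat_lattice_opp M). \<forall>y \<in> carrier (dual_flat_lattice_opp M).
           x \<sqsubseteq>\<^bsub>dual_flat_lattice_opp M\<^esub> y \<longleftrightarrow> f x \<sqsubseteq>\<^bsub>flat_lattice N\<^esub> f y) \<and>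
        (\<forall>x \<in> carrier (dual_flat_lattice_opp M).
           rk N (f x) = (card (ground M) - rk M (ground M)) - rk (dual M) x))"

end

theory Submission
  imports Defs
begin

text \<open>
  In corank three, the circuits of \<open>M\<close> are the complements of the lines of the rank-three matroid
  \<open>M\<^sup>*\<close>. A set of circuits is small iff it has at most two elements or consists of three
  non-concurrent lines. Two lines meet in rank at most one, so two concurrent triples
  sharing two lines together give four concurrent lines; hence the family of large sets is already
  stable under the operations generating the dependent sets, and the small sets are exactly the
  independent sets of the derived matroid. Each flat \<open>F\<close> of \<open>M\<^sup>*\<close> is an
  intersection of \<open>3 - r(F)\<close> lines, so sending \<open>F\<close> to the set of all lines containing it
  yields the rank-preserving order embedding.
\<close>

section \<open>Rank functions\<close>

text \<open>Instantiated with both \<open>rk M\<close> and \<open>rk (dual M)\<close>; for the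
  latter the axioms come from the corank formula \<open>rk_dual\<close>.\<close>

locale rank_function =
  fixes E :: "'a set" and r :: "'a set \<Rightarrow> nat"
  assumes finite_E: "finite E"
    and rank_le_card: "X \<subseteq> E \<Longrightarrow> r X \<le> card X"
    and rank_mono: "X \<subseteq> Y \<Longrightarrow> Y \<subseteq> E \<Longrightarrow> r X \<le> r Y"
    and rank_submodular:
      "X \<subseteq> E \<Longrightarrow> Y \<subseteq> E \<Longrightarrow> r (X \<union> Y) + r (X \<inter> Y) \<le> r X + r Y"
begin

definition closed :: "'a set \<Rightarrow> bool" where
  "closed F \<longleftrightarrow> F \<subseteq> E \<and> (\<forall>e \<in> E - F. r F < r (insert e F))"

definition hyperplane :: "'a set \<Rightarrow> bool" where
  "hyperplane H \<longleftrightarrow> closed H \<and> Suc (r H) = r E"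

lemma closed_subset: "closed F \<Longrightarrow> F \<subseteq> E"
  by (simp add: closed_def)

lemma closed_ground: "closed E"
  by (simp add: closed_def)

lemma rank_empty: "r {} = 0"
  using rank_le_card[of "{}"] by simp

lemma rank_insert_le:
  assumes "X \<subseteq> E" "e \<in> E"
  shows "r (insert e X) \<le> Suc (r X)"
  using rank_submodular[of X "{e}"] rank_le_card[of "{e}"] assms by simp

lemma rank_less_closed:
  assumes "closed F" "F \<subset> X" "X \<subseteq> E"
  shows "r F < r X"
proof -
  obtain e where e: "e \<in> X - F" using assms by blast
  then have "r F < r (insert e F)" using assms unfolding closed_def by blast
  also have "\<dots> \<le> r X" using assms e by (intro rank_mono) auto
  finally show ?thesis .
qed

text \<open>By submodularity, a point outside \<open>F\<close> raises the rank of
  \<open>F \<inter> G\<close> at least as much as that of \<open>F\<close>. A point outside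
  \<open>F \<inter> G\<close> is missed by \<open>F\<close> or by \<open>G\<close>.\<close>

lemma closed_Int:
  assumes F: "closed F" and G: "closed G"
  shows "closed (F \<inter> G)"
proof -
  have less: "r (F \<inter> G) < r (insert e (F \<inter> G))"
    if F: "closed F" and G: "closed G" and e: "e \<in> E - F" for e F G
  proof -
    have sub: "F \<subseteq> E" "G \<subseteq> E" using F G closed_subset by auto
    have "insert e (F \<inter> G) \<union> F = insert e F" "insert e (F \<inter> G) \<inter> F = F \<inter> G"
      using e by auto
    then have "r (insert e F) + r (F \<inter> G) \<le> r (insert e (F \<inter> G)) + r F"
      using rank_submodular[of "insert e (F \<inter> G)" F] sub e by auto
    moreover have "r F < r (insert e F)" using F e unfolding closed_def by blast
    ultimately show ?thesis by linarith
  qed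
  show ?thesis
    unfolding closed_def
    using closed_subset[OF F] less[OF F G] less[OF G F] by (auto simp: Int_commute)
qed

lemma closed_Inter:
  assumes "finite \<H>" "\<And>H. H \<in> \<H> \<Longrightarrow> closed H"
  shows "closed (E \<inter> \<Inter>\<H>)"
  using assms
proof (induction rule: finite_induct)
  case empty
  then show ?case by (simp add: closed_ground)
next
  case (insert H \<H>)
  then have "closed (H \<inter> (E \<inter> \<Inter>\<H>))" by (intro closed_Int[of H]) simp_all
  moreover have "H \<inter> (E \<inter> \<Inter>\<H>) = E \<inter> \<Inter>(insert H \<H>)" by auto
  ultimately show ?case by simp
qed

section \<open>Hyperplanes, and flats as intersections of hyperplanes\<close>

lemma rank_eq_if_spanning:
  assumes "A \<subseteq> E" and span: "\<And>x. x \<in> E \<Longrightarrow> r (insert x A) = r A"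
  shows "r E = r A"
proof -
  have "r (A \<union> X) = r A" if "finite X" "X \<subseteq> E" for X
    using that
  proof (induction rule: finite_induct)
    case empty
    then show ?case by simp
  next
    case (insert x X)
    \<comment> \<open>Both sets have the rank of \<open>A\<close> and their intersection contains
      \<open>A\<close>, so submodularity leaves no room for their union to grow.\<close>
    have "insert x A \<union> (A \<union> X) = A \<union> insert x X" by auto
    moreover have "r A \<le> r (insert x A \<inter> (A \<union> X))"
      using insert.prems assms(1) by (intro rank_mono) auto
    moreover have "r A \<le> r (A \<union> insert x X)"
      using insert.prems assms(1) by (intro rank_mono) auto
    ultimately show ?case
      using rank_submodular[of "insert x A" "A \<union> X"] insert assms(1) span[of x] by auto
  qed
  then show ?thesis
    using finite_E assms(1) by (metis Un_absorb1 subset_refl)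
qed

text \<open>The hyperplane is a maximal superset of \<open>F\<close> that does not span \<open>e\<close>.\<close>

lemma hyperplane_avoiding:
  assumes F: "closed F" and e: "e \<in> E - F"
  obtains H where "hyperplane H" "F \<subseteq> H" "e \<notin> H"
proof -
  define P where "P G \<longleftrightarrow> F \<subseteq> G \<and> G \<subseteq> E \<and> r G < r (insert e G)" for G
  have "P F" using F e unfolding P_def closed_def by auto
  moreover have "\<forall>G. P G \<longrightarrow> card G < Suc (card E)"
    using card_mono[OF finite_E] unfolding P_def by (auto simp: less_Suc_eq_le)
  ultimately obtain G where G: "P G" and max: "\<And>G'. P G' \<Longrightarrow> card G' \<le> card G"
    using ex_has_greatest_nat[of P F card "Suc (card E)"] by metis
  have GE: "G \<subseteq> E" and eG: "e \<notin> G" and less: "r G < r (insert e G)"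
    using G unfolding P_def by (auto simp: insert_absorb)
  have rG: "r (insert e G) = Suc (r G)"
    using rank_insert_le[OF GE, of e] less e by auto
  \<comment> \<open>By maximality of \<open>G\<close>, adding any further point yields a set that
    spans \<open>e\<close>.\<close>
  have step: "r (insert e (insert x G)) = r (insert x G)" if x: "x \<in> E - G" for x
  proof -
    have "card G < card (insert x G)"
      using x GE finite_E finite_subset by fastforce
    then have "\<not> P (insert x G)" using max by fastforce
    then have "r (insert e (insert x G)) \<le> r (insert x G)"
      using G x unfolding P_def by auto
    moreover have "r (insert x G) \<le> r (insert e (insert x G))"
      using x e GE by (intro rank_mono) auto
    ultimately show ?thesis by simp
  qed
  \<comment> \<open>Since \<open>insert x G\<close> spans \<open>e\<close> while \<open>G\<close>
    does not, \<open>x\<close> raises the rank of \<open>G\<close>; this makes \<open>G\<close>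
    closed.\<close>
  have up: "r (insert e G) \<le> r (insert x G)" if x: "x \<in> E - G" for x
  proof -
    have "r (insert e G) \<le> r (insert e (insert x G))"
      using x e GE by (intro rank_mono) auto
    then show ?thesis using step[OF x] by simp
  qed
  have "closed G"
    unfolding closed_def using GE up less by fastforce
  \<comment> \<open>For \<open>x\<close> outside \<open>G\<close>, the rank of
    \<open>insert x (insert e G)\<close> is that of \<open>insert x G\<close>, hence at most
    \<open>Suc (r G)\<close>; so \<open>insert e G\<close> already spans.\<close>
  moreover have "r E = r (insert e G)"
  proof (rule rank_eq_if_spanning)
    show "insert e G \<subseteq> E" using GE e by auto
    fix x assume x: "x \<in> E"
    show "r (insert x (insert e G)) = r (insert e G)"
    proof (cases "x \<in> G")
      case True
      then show ?thesis by (simp add: insert_absorb)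
    next
      case False
      then have "r (insert x (insert e G)) = r (insert x G)"
        using step[of x] x by (simp add: insert_commute)
      then show ?thesis
        using rank_insert_le[OF GE x] up[of x] x False rG by auto
    qed
  qed
  ultimately show ?thesis
    using that[of G] G eG rG unfolding hyperplane_def P_def by auto
qed

text \<open>\<open>F\<close> is the closure of \<open>A\<close>, found as a largest superset of the
  same rank: any further point must raise the rank.\<close>

lemma closed_superset:
  assumes "A \<subseteq> E"
  obtains F where "closed F" "A \<subseteq> F" "r F = r A"
proof -
  define P where "P G \<longleftrightarrow> A \<subseteq> G \<and> G \<subseteq> E \<and> r G = r A" for G
  have "P A" using assms unfolding P_def by auto
  moreover have "\<forall>G. P G \<longrightarrow> card G < Suc (card E)"
    using card_mono[OF finite_E] unfolding P_def by (auto simp: less_Suc_eq_le)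
  ultimately obtain G where G: "P G" and max: "\<And>G'. P G' \<Longrightarrow> card G' \<le> card G"
    using ex_has_greatest_nat[of P A card "Suc (card E)"] by metis
  have "r G < r (insert e G)" if e: "e \<in> E - G" for e
  proof -
    have "card G < card (insert e G)"
      using e G finite_subset[OF _ finite_E, of G] unfolding P_def by auto
    then have "\<not> P (insert e G)" using max by fastforce
    then have "r (insert e G) \<noteq> r G" using G e unfolding P_def by auto
    moreover have "r G \<le> r (insert e G)" using G e unfolding P_def by (intro rank_mono) auto
    ultimately show ?thesis by simp
  qed
  then show ?thesis using that[of G] G unfolding P_def closed_def by auto
qed

text \<open>Induction on the corank: enlarge \<open>F\<close> by a point \<open>e\<close> to a flat
  \<open>G\<close> of rank one higher, then cut \<open>G\<close> back to \<open>F\<close> with a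
  hyperplane through \<open>F\<close> avoiding \<open>e\<close>. The exact count later yields
  independent sets of circuits.\<close>

lemma closed_eq_Int_hyperplanes:
  assumes "closed F"
  shows "\<exists>\<H>. finite \<H> \<and> card \<H> = r E - r F \<and> E \<inter> \<Inter>\<H> = F \<and> (\<forall>H \<in> \<H>. hyperplane H)"
  using assms
proof (induction "r E - r F" arbitrary: F rule: less_induct)
  case less
  show ?case
  proof (cases "F = E")
    case True
    then show ?thesis by (intro exI[of _ "{}"]) auto
  next
    case False
    have FE: "F \<subseteq> E" using less.prems closed_subset by auto
    then obtain e where e: "e \<in> E - F" using False by auto
    obtain H where H: "hyperplane H" "F \<subseteq> H" "e \<notin> H"
      using hyperplane_avoiding[OF less.prems e] .
    obtain G where G: "closed G" "insert e F \<subseteq> G" "r G = r (insert e F)"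
      using closed_superset[of "insert e F"] e FE by auto
    have GE: "G \<subseteq> E" using G(1) closed_subset by simp
    have less_G: "r F < r (insert e F)" using less.prems e unfolding closed_def by auto
    have rG: "r G = Suc (r F)"
      using less_G rank_insert_le[OF FE, of e] e G(3) by simp
    have "r G \<le> r E" using GE by (intro rank_mono) auto
    then have "r E - r G < r E - r F" using rG by linarith
    then obtain \<H> where \<H>: "finite \<H>" "card \<H> = r E - r G" "E \<inter> \<Inter>\<H> = G"
      "\<forall>H' \<in> \<H>. hyperplane H'"
      using less.hyps[of G] G(1) by auto
    have clGH: "closed (G \<inter> H)" using G(1) H(1) closed_Int unfolding hyperplane_def by auto
    have "G \<inter> H \<subset> G" using G(2) H(3) by auto
    then have "r (G \<inter> H) < r G" using GE clGH by (intro rank_less_closed)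
    moreover have "F \<subseteq> G \<inter> H" using G(2) H(2) by auto
    \<comment> \<open>\<open>G \<inter> H\<close> contains \<open>F\<close> and has rank below that
      of \<open>G\<close>, which exceeds the rank of \<open>F\<close> by only one.\<close>
    ultimately have "G \<inter> H = F"
      using rank_less_closed[OF less.prems, of "G \<inter> H"] GE rG by fastforce
    \<comment> \<open>Every member of \<open>\<H>\<close> contains \<open>G\<close> and so
      \<open>e\<close>, which \<open>H\<close> avoids.\<close>
    moreover have "H \<notin> \<H>" using \<H>(3) H(3) G(2) by auto
    then have "card (insert H \<H>) = r E - r F"
      using \<H>(1,2) rG \<open>r G \<le> r E\<close> by simp
    ultimately show ?thesis
      using \<H> H(1) by (intro exI[of _ "insert H \<H>"]) auto
  qed
qed

end


section \<open>The dual rank function\<close>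

text \<open>Stated for a bare record, without the matroid axioms, so that ranks in
  \<open>dual M\<close> can be computed directly from its independent sets.\<close>

lemma rk_eqI:
  assumes "finite (ground M)" "\<And>I. indep M I \<Longrightarrow> I \<subseteq> ground M"
    and "indep M J" "J \<subseteq> X" "card J = k"
    and "\<And>I. indep M I \<Longrightarrow> I \<subseteq> X \<Longrightarrow> card I \<le> k"
  shows "rk M X = k"
  unfolding rk_def
proof (rule Max_eqI)
  have "{I. indep M I \<and> I \<subseteq> X} \<subseteq> Pow (ground M)" using assms(2) by auto
  then show "finite (card ` {I. indep M I \<and> I \<subseteq> X})"
    using assms(1) by (meson finite_Pow_iff finite_imageI finite_subset)
qed (use assms in auto)

context matroid
begin

lemma finite_indep: "indep M I \<Longrightarrow> finite I"
  using finite_ground indep_subset_ground finite_subset by blast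

lemma finite_indep_sets: "finite {I. indep M I \<and> I \<subseteq> X}"
proof -
  have "{I. indep M I \<and> I \<subseteq> X} \<subseteq> Pow (ground M)" using indep_subset_ground by auto
  then show ?thesis using finite_ground by (meson finite_Pow_iff finite_subset)
qed

lemma card_le_rk: "indep M I \<Longrightarrow> I \<subseteq> X \<Longrightarrow> card I \<le> rk M X"
  unfolding rk_def using finite_indep_sets by (intro Max_ge) auto

lemma rk_attained: obtains I where "indep M I" "I \<subseteq> X" "card I = rk M X"
proof -
  have "rk M X \<in> card ` {I. indep M I \<and> I \<subseteq> X}"
    unfolding rk_def using finite_indep_sets indep_empty by (intro Max_in) auto
  then show ?thesis using that by auto
qed

lemma indep_extend:
  assumes "indep M I" "I \<subseteq> X"
  obtains J where "indep M J" "I \<subseteq> J" "J \<subseteq> X" "card J = rk M X"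
proof -
  define P where "P J \<longleftrightarrow> indep M J \<and> I \<subseteq> J \<and> J \<subseteq> X" for J
  have "P I" using assms unfolding P_def by auto
  moreover have "\<forall>J. P J \<longrightarrow> card J < Suc (rk M X)"
    using card_le_rk unfolding P_def by (auto simp: less_Suc_eq_le)
  ultimately obtain J where J: "P J" and max: "\<And>J'. P J' \<Longrightarrow> card J' \<le> card J"
    using ex_has_greatest_nat[of P I card "Suc (rk M X)"] by metis
  have "card J = rk M X"
  proof (rule ccontr)
    assume "card J \<noteq> rk M X"
    then have "card J < rk M X" using J card_le_rk unfolding P_def by (simp add: le_neq_implies_less)
    moreover obtain K where K: "indep M K" "K \<subseteq> X" "card K = rk M X" by (rule rk_attained)
    ultimately obtain y where y: "y \<in> K - J" "indep M (insert y J)"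
      using indep_augment[of J K] J unfolding P_def by auto
    then have "P (insert y J)" using J K unfolding P_def by auto
    moreover have "finite J" using J finite_indep unfolding P_def by auto
    ultimately show False using max[of "insert y J"] y by simp
  qed
  then show ?thesis using that J unfolding P_def by auto
qed

lemma rank_function_rk: "rank_function (ground M) (rk M)"
proof
  show "finite (ground M)" by (rule finite_ground)
  show "rk M X \<le> card X" if "X \<subseteq> ground M" for X
    using rk_attained[of X] that by (metis card_mono finite_ground finite_subset)
  show "rk M X \<le> rk M Y" if "X \<subseteq> Y" for X Y
    using rk_attained[of X] that card_le_rk by (metis order_trans)
  show "rk M (X \<union> Y) + rk M (X \<inter> Y) \<le> rk M X + rk M Y" for X Y
  proof -
    \<comment> \<open>A basis \<open>I\<close> of the intersection is extended to a basis
      \<open>J\<close> of the union; the traces of \<open>J\<close> on \<open>X\<close> and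
      \<open>Y\<close> are independent and overlap at least in \<open>I\<close>.\<close>
    obtain I where I: "indep M I" "I \<subseteq> X \<inter> Y" "card I = rk M (X \<inter> Y)" by (rule rk_attained)
    obtain J where J: "indep M J" "I \<subseteq> J" "J \<subseteq> X \<union> Y" "card J = rk M (X \<union> Y)"
      using indep_extend[OF I(1), of "X \<union> Y"] I(2) by auto
    have fin: "finite J" using J finite_indep by auto
    have "card (J \<inter> X) + card (J \<inter> Y) = card ((J \<inter> X) \<union> (J \<inter> Y)) + card ((J \<inter> X) \<inter> (J \<inter> Y))"
      using fin by (intro card_Un_Int) auto
    moreover have "(J \<inter> X) \<union> (J \<inter> Y) = J" using J by auto
    moreover have "card I \<le> card ((J \<inter> X) \<inter> (J \<inter> Y))"
      using I J fin by (intro card_mono) auto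
    moreover have "card (J \<inter> X) \<le> rk M X" "card (J \<inter> Y) \<le> rk M Y"
      using J(1) indep_subset by (auto intro!: card_le_rk)
    ultimately show ?thesis using I J by auto
  qed
qed

sublocale primal: rank_function "ground M" "rk M"
  by (rule rank_function_rk)

lemma basis_iff: "basis M B \<longleftrightarrow> indep M B \<and> card B = rk M (ground M)"
proof
  assume B: "basis M B"
  then have "indep M B" unfolding basis_def by auto
  then obtain J where "indep M J" "B \<subseteq> J" "card J = rk M (ground M)"
    using indep_extend indep_subset_ground by metis
  then show "indep M B \<and> card B = rk M (ground M)" using B unfolding basis_def by auto
next
  assume B: "indep M B \<and> card B = rk M (ground M)"
  have "I = B" if "indep M I" "B \<subseteq> I" for I
    using that B card_le_rk[of I "ground M"] indep_subset_ground finite_indep card_seteq by metis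
  then show "basis M B" using B unfolding basis_def by auto
qed

text \<open>For a basis B, the set X - B has size |X| - r(M) + |B - X|, so the dual rank calls for a
  basis with as much as possible outside X: extend a maximal independent subset of the complement.
  The additive form avoids truncated subtraction.\<close>

lemma rk_dual:
  assumes X: "X \<subseteq> ground M"
  shows "rk (dual M) X + rk M (ground M) = card X + rk M (ground M - X)"
proof -
  have card_diff: "card (X - B) + rk M (ground M) = card X + card (B - X)" if "basis M B" for B
  proof -
    have B: "indep M B" "card B = rk M (ground M)" "finite B"
      using that basis_iff finite_indep by auto
    have "card B = card (B \<inter> X) + card (B - X)"
      using B(3) by (simp add: card_Diff_subset_Int card_mono)
    moreover have "finite X" using X finite_ground finite_subset by blast
    then have "card X = card (X \<inter> B) + card (X - B)"
      by (simp add: card_Diff_subset_Int card_mono)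
    ultimately show ?thesis using B by (simp add: Int_commute)
  qed
  obtain I where I: "indep M I" "I \<subseteq> ground M - X" "card I = rk M (ground M - X)"
    by (rule rk_attained)
  obtain B where B: "indep M B" "I \<subseteq> B" "B \<subseteq> ground M" "card B = rk M (ground M)"
    using indep_extend[OF I(1), of "ground M"] I(2) by auto
  have bas: "basis M B" using B basis_iff by auto
  have upper: "card (B' - X) \<le> rk M (ground M - X)" if "basis M B'" for B'
  proof (rule card_le_rk)
    have "indep M B'" using that basis_iff by auto
    then show "indep M (B' - X)" "B' - X \<subseteq> ground M - X"
      using indep_subset[of B' "B' - X"] indep_subset_ground[of B'] by auto
  qed
  have "card I \<le> card (B - X)"
    using B I finite_indep by (intro card_mono) auto
  then have attained: "card (B - X) = rk M (ground M - X)" using upper[OF bas] I by simp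
  have "rk (dual M) X = card (X - B)"
  proof (rule rk_eqI)
    show "finite (ground (dual M))" by (simp add: dual_def finite_ground)
    show "I \<subseteq> ground (dual M)" if "indep (dual M) I" for I using that by (auto simp: dual_def)
    show "indep (dual M) (X - B)" using bas X by (auto simp: dual_def)
    show "card I \<le> card (X - B)" if "indep (dual M) I" "I \<subseteq> X" for I
    proof -
      obtain B' where B': "basis M B'" "I \<subseteq> ground M - B'" using \<open>indep (dual M) I\<close>
        by (auto simp: dual_def)
      then have "card I \<le> card (X - B')"
        using that X finite_ground by (intro card_mono) (auto intro: finite_subset)
      then show ?thesis
        using card_diff[OF B'(1)] card_diff[OF bas] upper[OF B'(1)] attained by linarith
    qed
  qed auto
  then show ?thesis using card_diff[OF bas] attained by simp
qed

lemma rank_function_rk_dual: "rank_function (ground M) (rk (dual M))"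
proof
  let ?E = "ground M"
  show "finite ?E" by (rule finite_ground)
  have fin: "finite X" if "X \<subseteq> ?E" for X using that finite_ground finite_subset by blast
  show "rk (dual M) X \<le> card X" if "X \<subseteq> ?E" for X
    using rk_dual[OF that] primal.rank_mono[of "?E - X" ?E] by auto
  show "rk (dual M) X \<le> rk (dual M) Y" if "X \<subseteq> Y" "Y \<subseteq> ?E" for X Y
  proof -
    have XE: "X \<subseteq> ?E" using that by auto
    \<comment> \<open>Passing from the complement of \<open>Y\<close> to that of \<open>X\<close>
      adds the points of \<open>Y - X\<close>, so the rank in \<open>M\<close> grows by at most
      their number.\<close>
    have "(?E - Y) \<union> (Y - X) = ?E - X" using that by auto
    then have "rk M (?E - X) \<le> rk M (?E - Y) + rk M (Y - X)"
      using primal.rank_submodular[of "?E - Y" "Y - X"] that by fastforce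
    moreover have "rk M (Y - X) \<le> card (Y - X)" using that by (intro primal.rank_le_card) auto
    moreover have "card Y = card X + card (Y - X)"
      using that XE fin by (metis card_Diff_subset card_mono le_add_diff_inverse)
    ultimately show ?thesis using rk_dual[OF XE] rk_dual[OF that(2)] by linarith
  qed
  show "rk (dual M) (X \<union> Y) + rk (dual M) (X \<inter> Y) \<le> rk (dual M) X + rk (dual M) Y"
    if XY: "X \<subseteq> ?E" "Y \<subseteq> ?E" for X Y
  proof -
    have sub: "X \<union> Y \<subseteq> ?E" "X \<inter> Y \<subseteq> ?E" using XY by auto
    have "rk M (?E - (X \<inter> Y)) + rk M (?E - (X \<union> Y)) \<le> rk M (?E - X) + rk M (?E - Y)"
      using primal.rank_submodular[of "?E - X" "?E - Y"] by (simp add: Diff_Int Diff_Un)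
    moreover have "card X + card Y = card (X \<union> Y) + card (X \<inter> Y)"
      using fin XY by (intro card_Un_Int) auto
    ultimately show ?thesis
      using rk_dual[OF XY(1)] rk_dual[OF XY(2)] rk_dual[OF sub(1)] rk_dual[OF sub(2)] by linarith
  qed
qed

sublocale dualr: rank_function "ground M" "rk (dual M)"
  by (rule rank_function_rk_dual)

section \<open>Flats of the dual, and circuits as complements of its hyperplanes\<close>

lemma corank: "card (ground M) - rk M (ground M) = rk (dual M) (ground M)"
  using rk_dual[of "ground M"] primal.rank_empty by simp

lemma ground_dual: "ground (dual M) = ground M"
  by (simp add: dual_def)

lemma flats_dual_iff: "F \<in> flats (dual M) \<longleftrightarrow> dualr.closed F"
proof -
  have "rk (dual M) (insert e F) \<noteq> rk (dual M) F \<longleftrightarrow> rk (dual M) F < rk (dual M) (insert e F)"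
    if "F \<subseteq> ground M" "e \<in> ground M" for e
    using dualr.rank_mono[of F "insert e F"] that by (metis insert_subsetI nless_le subset_insertI)
  then show ?thesis
    unfolding flats_def closure_def dualr.closed_def ground_dual
    by (auto simp: insert_absorb)
qed

lemma indep_iff_rk: "X \<subseteq> ground M \<Longrightarrow> indep M X \<longleftrightarrow> rk M X = card X"
  using rk_attained[of X] card_le_rk[of X X] primal.rank_le_card[of X]
  by (metis card_subset_eq finite_ground finite_subset le_antisym subset_refl)

text \<open>Through \<open>rk_dual\<close>, corank one of the complement says that C has rank |C| -
  1, and closedness says that deleting a point of C does not lower the rank. Together: C is
  dependent and all its one-point deletions are independent.\<close>

lemma circuits_iff_hyperplane:
  assumes C: "C \<subseteq> ground M"
  shows "C \<in> circuits M \<longleftrightarrow> dualr.hyperplane (ground M - C)"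
proof -
  let ?E = "ground M"
  have fin: "finite C" using C finite_ground finite_subset by blast
  have rC: "rk (dual M) (?E - C) + rk M ?E + card C = card ?E + rk M C"
  proof -
    have "?E - (?E - C) = C" "card ?E = card (?E - C) + card C"
      using C fin finite_ground by (auto simp: card_Diff_subset card_mono)
    then show ?thesis using rk_dual[of "?E - C"] by simp
  qed
  have re: "rk (dual M) (insert e (?E - C)) + rk M ?E + card C = Suc (card ?E + rk M (C - {e}))"
    if "e \<in> C" for e
  proof -
    have "?E - insert e (?E - C) = C - {e}" using C that by auto
    moreover have "card (insert e (?E - C)) = Suc (card (?E - C))"
      using that finite_ground by simp
    moreover have "card ?E = card (?E - C) + card C"
      using C fin finite_ground by (auto simp: card_Diff_subset card_mono)
    ultimately show ?thesis using rk_dual[of "insert e (?E - C)"] that C by auto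
  qed
  have rE: "rk (dual M) ?E + rk M ?E = card ?E"
    using rk_dual[of ?E] primal.rank_empty by simp
  have circ: "C \<in> circuits M \<longleftrightarrow> rk M C < card C \<and> (\<forall>e \<in> C. Suc (rk M (C - {e})) = card C)"
  proof -
    have "C \<in> circuits M \<longleftrightarrow> \<not> indep M C \<and> (\<forall>e \<in> C. indep M (C - {e}))"
    proof
      assume "C \<in> circuits M"
      then show "\<not> indep M C \<and> (\<forall>e \<in> C. indep M (C - {e}))" unfolding circuits_def by blast
    next
      assume R: "\<not> indep M C \<and> (\<forall>e \<in> C. indep M (C - {e}))"
      have "indep M D" if "D \<subset> C" for D
      proof -
        obtain e where "e \<in> C" "e \<notin> D" using \<open>D \<subset> C\<close> by blast
        then have "D \<subseteq> C - {e}" using that by blast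
        then show ?thesis using R \<open>e \<in> C\<close> indep_subset by blast
      qed
      then show "C \<in> circuits M" using R C unfolding circuits_def by auto
    qed
    moreover have "\<not> indep M C \<longleftrightarrow> rk M C < card C"
      using indep_iff_rk[OF C] primal.rank_le_card[OF C] by auto
    moreover have "indep M (C - {e}) \<longleftrightarrow> Suc (rk M (C - {e})) = card C" if "e \<in> C" for e
      using indep_iff_rk[of "C - {e}"] C card_Suc_Diff1[OF fin that]
      by (metis Diff_subset nat.inject subset_trans)
    ultimately show ?thesis by auto
  qed
  show ?thesis
  proof
    assume L: "C \<in> circuits M"
    \<comment> \<open>Deleting a point of the circuit leaves an independent set, which bounds the
      rank of \<open>C\<close> from below by |C| - 1.\<close>
    have ne: "C \<noteq> {}" using L indep_empty unfolding circuits_def by auto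
    then obtain c where c: "c \<in> C" by auto
    have "Suc (rk M (C - {c})) = card C" using circ L c by auto
    moreover have "rk M (C - {c}) \<le> rk M C" using C by (intro primal.rank_mono) auto
    ultimately have k: "Suc (rk M C) = card C" using circ L by auto
    have "rk (dual M) (?E - C) < rk (dual M) (insert e (?E - C))" if "e \<in> C" for e
    proof -
      have "Suc (rk M (C - {e})) = card C" using circ L that by blast
      then show ?thesis using re[OF that] rC k by linarith
    qed
    moreover have "Suc (rk (dual M) (?E - C)) = rk (dual M) ?E" using rC rE k by linarith
    ultimately show "dualr.hyperplane (?E - C)"
      unfolding dualr.hyperplane_def dualr.closed_def by auto
  next
    assume R: "dualr.hyperplane (?E - C)"
    then have k: "Suc (rk (dual M) (?E - C)) = rk (dual M) ?E"
      and cl: "dualr.closed (?E - C)" unfolding dualr.hyperplane_def by auto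
    \<comment> \<open>A closed set of corank one plus a further point has full dual rank;
      \<open>re\<close> translates this into independence of \<open>C - {e}\<close>.\<close>
    have "Suc (rk M (C - {e})) = card C" if "e \<in> C" for e
    proof -
      have "rk (dual M) (?E - C) < rk (dual M) (insert e (?E - C))"
        using cl that C unfolding dualr.closed_def by blast
      moreover have "rk (dual M) (insert e (?E - C)) \<le> rk (dual M) ?E"
        using that C by (intro dualr.rank_mono) auto
      ultimately show ?thesis using re[OF that] rE k by linarith
    qed
    moreover have "rk M C < card C" using rC rE k by linarith
    ultimately show "C \<in> circuits M" using circ by blast
  qed
qed

end


section \<open>The derived matroid in corank three\<close>

lemma eps_closureE:
  assumes "B \<in> eps_closure \<AA>"
  obtains "B \<in> \<AA>"
  | A1 A2 C where "B = (A1 \<union> A2) - {C}" "A1 \<in> \<AA>" "A2 \<in> \<AA>" "A1 \<inter> A2 \<notin> \<AA>" "C \<in> A1 \<inter> A2"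
  using assms unfolding eps_closure_def by blast

text \<open>\<open>bottom\<close> is defined by Hilbert choice, so antisymmetry is what identifies
  it with a given least element.\<close>

lemma bottom_eqI:
  assumes "\<And>x y. le L x y \<Longrightarrow> le L y x \<Longrightarrow> x = y"
    and "m \<in> carrier L" "\<And>x. x \<in> carrier L \<Longrightarrow> le L m x"
  shows "bottom L = m"
proof -
  have "least L m (carrier L)" using assms(2,3) by (auto simp: least_def)
  then have "least L (bottom L) (carrier L)"
    unfolding bottom_def sup_def by (rule someI)
  then show ?thesis using assms by (auto simp: least_def)
qed

locale corank_three = matroid +
  assumes rk_dual_ground: "rk (dual M) (ground M) = 3"
begin

text \<open>A circuit \<open>C\<close> stands for the hyperplane \<open>ground M - C\<close> of the dual matroid, so
  \<open>common S\<close> is the intersection of the hyperplanes represented by \<open>S\<close>.\<close>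

abbreviation common :: "'a set set \<Rightarrow> 'a set" where
  "common S \<equiv> ground M - \<Union>S"

section \<open>Intersections of lines of the dual\<close>

lemma circuit_subset_ground: "C \<in> circuits M \<Longrightarrow> C \<subseteq> ground M"
  unfolding circuits_def by auto

lemma finite_circuits: "finite (circuits M)"
proof -
  have "circuits M \<subseteq> Pow (ground M)" unfolding circuits_def by auto
  then show ?thesis using finite_ground by (meson finite_Pow_iff finite_subset)
qed

lemma circuit_subset_eq: "C \<in> circuits M \<Longrightarrow> D \<in> circuits M \<Longrightarrow> C \<subseteq> D \<Longrightarrow> C = D"
  unfolding circuits_def by blast

lemma hyperplane_compl: "C \<in> circuits M \<Longrightarrow> dualr.hyperplane (ground M - C)"
  using circuits_iff_hyperplane circuit_subset_ground by blast

lemma rank_compl: "C \<in> circuits M \<Longrightarrow> rk (dual M) (ground M - C) = 2"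
  using hyperplane_compl[of C] rk_dual_ground unfolding dualr.hyperplane_def by simp

lemma closed_common:
  assumes "S \<subseteq> circuits M"
  shows "dualr.closed (common S)"
proof -
  have "common S = ground M \<inter> \<Inter>((\<lambda>C. ground M - C) ` S)" by auto
  moreover have "finite ((\<lambda>C. ground M - C) ` S)"
    using assms finite_circuits finite_subset by blast
  moreover have "dualr.closed H" if "H \<in> (\<lambda>C. ground M - C) ` S" for H
    using that hyperplane_compl assms unfolding dualr.hyperplane_def by blast
  ultimately show ?thesis using dualr.closed_Inter by metis
qed

text \<open>Circuits form an antichain, so the common flat is a proper subset of a hyperplane of
  rank two.\<close>

lemma rank_common_pair:
  assumes S: "S \<subseteq> circuits M" and "card S = 2"
  shows "rk (dual M) (common S) \<le> 1"
proof -
  obtain C D where CD: "S = {C, D}" "C \<noteq> D" using \<open>card S = 2\<close> by (meson card_2_iff)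
  then have mem: "C \<in> circuits M" "D \<in> circuits M" using S by auto
  then have "\<not> D \<subseteq> C" using circuit_subset_eq CD by blast
  then have "common S \<subset> ground M - C" using CD circuit_subset_ground[OF mem(2)] by auto
  then show ?thesis
    using dualr.rank_less_closed[OF closed_common[OF S], of "ground M - C"] rank_compl[OF mem(1)]
    by auto
qed

text \<open>Two lines already meet in rank at most one, so further lines either keep their common
  flat or cut it down to rank zero.\<close>

lemma common_eq_if_rank_pos:
  assumes "card X = 2" "X \<subseteq> Y" "Y \<subseteq> circuits M" "0 < rk (dual M) (common Y)"
  shows "common Y = common X"
proof (rule ccontr)
  assume "common Y \<noteq> common X"
  then have "common Y \<subset> common X" using assms by auto
  then have "rk (dual M) (common Y) < rk (dual M) (common X)"
    using closed_common[OF assms(3)] by (intro dualr.rank_less_closed) auto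
  moreover have "rk (dual M) (common X) \<le> 1" using assms by (intro rank_common_pair) auto
  ultimately show False using assms by linarith
qed

section \<open>Small and large sets of circuits\<close>

lemma small_circuit_sets_iff:
  "S \<in> small_circuit_sets M \<longleftrightarrow>
    S \<subseteq> circuits M \<and> card S \<le> 3 - rk (dual M) (common S)"
proof -
  have "ground M \<inter> (\<Inter>C\<in>S. ground M - C) = common S" by blast
  then show ?thesis unfolding small_circuit_sets_def corank rk_dual_ground by simp
qed

text \<open>For sizes zero, one and two the common flat has rank three, two and at most one, so the
  bound is automatic; from size three on it forces size three and rank zero.\<close>

lemma small_iff:
  assumes S: "S \<subseteq> circuits M"
  shows "S \<in> small_circuit_sets M \<longleftrightarrow>
    card S \<le> 2 \<or> card S = 3 \<and> rk (dual M) (common S) = 0"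
proof -
  have le3: "rk (dual M) (common S) \<le> 3"
    using dualr.rank_mono[of "common S" "ground M"] rk_dual_ground by auto
  consider "card S = 0" | "card S = 1" | "card S = 2" | "card S \<ge> 3" by linarith
  then show ?thesis
  proof cases
    case 1
    then show ?thesis using S small_circuit_sets_iff by auto
  next
    case 2
    then obtain C where C: "S = {C}" by (meson card_1_singletonE)
    then have "rk (dual M) (common S) = 2" using S rank_compl by auto
    then show ?thesis using S small_circuit_sets_iff 2 by auto
  next
    case 3
    then show ?thesis using S small_circuit_sets_iff rank_common_pair[OF S] by auto
  next
    case 4
    then show ?thesis using S small_circuit_sets_iff by auto
  qed
qed

lemma large_iff:
  "A \<in> Pow (circuits M) - small_circuit_sets M \<longleftrightarrow>
    A \<subseteq> circuits M \<and> (4 \<le> card A \<or> card A = 3 \<and> 0 < rk (dual M) (common A))"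
  using small_iff[of A] by auto

lemma up_closure_eps_closure_large:
  "up_closure (circuits M) (eps_closure (Pow (circuits M) - small_circuit_sets M)) =
    Pow (circuits M) - small_circuit_sets M" (is "up_closure ?K (eps_closure ?L) = ?L")
proof
  show "?L \<subseteq> up_closure ?K (eps_closure ?L)"
    unfolding up_closure_def eps_closure_def by blast
  \<comment> \<open>A proper superset of a large set has at least four elements, hence is large
    whatever its common flat.\<close>
  have up: "A \<in> ?L" if B: "B \<in> ?L" and "B \<subseteq> A" "A \<subseteq> ?K" for A B
  proof (cases "A = B")
    case False
    have "finite A" using that finite_circuits finite_subset by blast
    then have "card B < card A" using that False by (intro psubset_card_mono) auto
    then show ?thesis using B that unfolding large_iff by linarith
  qed (use B in simp)
  have eps: "B \<in> ?L" if "B \<in> eps_closure ?L" for B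
    using that
  proof (cases rule: eps_closureE)
    case (2 A1 A2 C)
    note B = 2(1) and A = 2(2-5)
    have sub: "A1 \<subseteq> ?K" "A2 \<subseteq> ?K" using A by auto
    have fin: "finite A1" "finite A2" using sub finite_circuits finite_subset by blast+
    have BK: "B \<subseteq> ?K" using B sub by auto
    have cB: "Suc (card B) = card (A1 \<union> A2)"
      unfolding B using fin A(4) by (intro card_Suc_Diff1) auto
    show ?thesis
    proof (cases "4 \<le> card B")
      case True
      then show ?thesis unfolding large_iff using BK by simp
    next
      case False
      \<comment> \<open>A containment would make \<open>A1 \<inter> A2\<close> equal to one of the
        two large sets.\<close>
      have "\<not> A1 \<subseteq> A2" "\<not> A2 \<subseteq> A1" using A by (metis Int_absorb1 Int_absorb2)+
      then have "A1 \<subset> A1 \<union> A2" "A2 \<subset> A1 \<union> A2" by blast+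
      then have less: "card A1 < card (A1 \<union> A2)" "card A2 < card (A1 \<union> A2)"
        using fin by (meson finite_UnI psubset_card_mono)+
      \<comment> \<open>The union has one element more than \<open>B\<close>, so at most four; hence
        both sets are concurrent triples, and they share two lines.\<close>
      have "card A1 < 4" "card A2 < 4" using less False cB by linarith+
      then have three: "card A1 = 3" "card A2 = 3"
        "0 < rk (dual M) (common A1)" "0 < rk (dual M) (common A2)"
        using A(1,2) unfolding large_iff by linarith+
      then have four: "card (A1 \<union> A2) = 4" using less False cB by linarith
      have "card (A1 \<inter> A2) = 2" using card_Un_Int[OF fin] three four by simp
      then have "common A1 = common (A1 \<inter> A2)" "common A2 = common (A1 \<inter> A2)"
        using common_eq_if_rank_pos[of "A1 \<inter> A2" A1] common_eq_if_rank_pos[of "A1 \<inter> A2" A2]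
          three sub by simp_all
      \<comment> \<open>All four lines pass through one flat of positive rank, so the three
        remaining after deleting \<open>C\<close> are concurrent.\<close>
      then have "common A1 \<subseteq> common B" unfolding B by blast
      then have "rk (dual M) (common A1) \<le> rk (dual M) (common B)"
        by (intro dualr.rank_mono) auto
      then show ?thesis unfolding large_iff using BK cB four three by simp
    qed
  qed simp
  show "up_closure ?K (eps_closure ?L) \<subseteq> ?L"
  proof
    fix A assume "A \<in> up_closure ?K (eps_closure ?L)"
    then obtain B where "B \<in> eps_closure ?L" "B \<subseteq> A" "A \<subseteq> ?K"
      unfolding up_closure_def by blast
    then show "A \<in> ?L" using up eps by metis
  qed
qed

lemma dependent_hull_large:
  "dependent_hull (circuits M) (Pow (circuits M) - small_circuit_sets M) =
    Pow (circuits M) - small_circuit_sets M" (is "dependent_hull ?K ?L = ?L")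
proof -
  have "((\<lambda>\<BB>. up_closure ?K (eps_closure \<BB>)) ^^ i) ?L = ?L" for i
    by (induction i) (simp_all add: up_closure_eps_closure_large)
  then show ?thesis unfolding dependent_hull_def by simp
qed

section \<open>Matroid axioms for the derived matroid\<close>

lemma ground_derived: "ground (derived_matroid M) = circuits M"
  by (simp add: derived_matroid_def)

lemma indep_derived: "indep (derived_matroid M) S \<longleftrightarrow> S \<in> small_circuit_sets M"
  unfolding derived_matroid_def dependent_hull_large
  by (auto simp: small_circuit_sets_iff)

text \<open>All sets of at most two circuits are independent, so augmentation matters only from a
  pair \<open>X\<close> to a triple \<open>Y\<close>. If no element worked, every line of
  \<open>Y\<close> would pass through the common flat of \<open>X\<close>, of positive rank, making
  \<open>Y\<close> dependent.\<close>

lemma matroid_derived: "matroid (derived_matroid M)"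
proof
  let ?N = "derived_matroid M"
  show "finite (ground ?N)" by (simp add: ground_derived finite_circuits)
  show sub: "X \<subseteq> ground ?N" if "indep ?N X" for X
    using that by (simp add: indep_derived ground_derived small_circuit_sets_iff)
  show "indep ?N {}" by (simp add: indep_derived small_iff)
  show "indep ?N Y" if X: "indep ?N X" and Y: "Y \<subseteq> X" for X Y
  proof (cases "Y = X")
    case False
    have XK: "X \<subseteq> circuits M" using sub[OF X] by (simp add: ground_derived)
    have "card Y < card X"
      using XK Y False finite_circuits finite_subset by (intro psubset_card_mono) auto
    then show ?thesis using X XK Y unfolding indep_derived by (auto simp: small_iff)
  qed (use X in simp)
  show "\<exists>y \<in> Y - X. indep ?N (insert y X)"
    if X: "indep ?N X" and Y: "indep ?N Y" and less: "card X < card Y" for X Y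
  proof -
    have K: "X \<subseteq> circuits M" "Y \<subseteq> circuits M" using sub X Y by (auto simp: ground_derived)
    have fin: "finite X" "finite Y" using K finite_circuits finite_subset by blast+
    have "\<not> Y \<subseteq> X" using less fin card_mono leD by blast
    then obtain y where y: "y \<in> Y - X" by auto
    have cY: "card Y \<le> 2 \<or> card Y = 3 \<and> rk (dual M) (common Y) = 0"
      using Y K(2) by (simp add: indep_derived small_iff)
    show ?thesis
    proof (cases "card X < 2")
      case True
      then have "card (insert y X) \<le> 2" using fin y by simp
      then have "indep ?N (insert y X)" using K y by (subst indep_derived, subst small_iff) auto
      then show ?thesis using y by blast
    next
      case False
      then have two: "card X = 2" and rY: "rk (dual M) (common Y) = 0" using cY less by auto
      show ?thesis
      proof (rule ccontr)
        assume none: "\<not> (\<exists>y \<in> Y - X. indep ?N (insert y X))"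
        have pos: "0 < rk (dual M) (common (insert z X))" if z: "z \<in> Y - X" for z
        proof -
          have "insert z X \<subseteq> circuits M" "card (insert z X) = 3" using K z two fin by auto
          then show ?thesis using none z small_iff[of "insert z X"] indep_derived by auto
        qed
        have eq: "common (insert z X) = common X" if z: "z \<in> Y - X" for z
          using K z pos[OF z] two by (intro common_eq_if_rank_pos) auto
        have "common X \<subseteq> common Y"
        proof
          fix x assume x: "x \<in> common X"
          have "x \<notin> z" if "z \<in> Y" for z
            using eq[of z] that x by (cases "z \<in> X") auto
          then show "x \<in> common Y" using x by auto
        qed
        then have "rk (dual M) (common X) \<le> rk (dual M) (common Y)"
          by (intro dualr.rank_mono) auto
        then show False using pos[OF y] eq[OF y] rY by simp
      qed
    qed
  qed
qed

sublocale derived: matroid "derived_matroid M"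
  by (rule matroid_derived)

section \<open>Ranks in the derived matroid and the order embedding\<close>

lemma rk_derived_le:
  assumes "S \<subseteq> circuits M"
  shows "rk (derived_matroid M) S \<le> 3 - rk (dual M) (common S)"
proof -
  obtain I where I: "indep (derived_matroid M) I" "I \<subseteq> S" "card I = rk (derived_matroid M) S"
    by (rule derived.rk_attained)
  have "card I \<le> 3 - rk (dual M) (common I)"
    using I(1) by (simp add: indep_derived small_circuit_sets_iff)
  moreover have "rk (dual M) (common S) \<le> rk (dual M) (common I)"
    using I(2) by (intro dualr.rank_mono) auto
  ultimately show ?thesis using I(3) by linarith
qed

text \<open>Rank preservation, flatness and order reflection of the embedding \<open>adj\<close> below all rest on
  these sets: \<open>S\<close> is independent in the derived matroid and has the largest possible rank
  among the sets of hyperplanes containing \<open>F\<close>.\<close>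

lemma flat_eq_common:
  assumes "dualr.closed F"
  obtains S where "S \<subseteq> circuits M" "card S = 3 - rk (dual M) F" "common S = F"
proof -
  obtain \<H> where \<H>: "finite \<H>" "card \<H> = 3 - rk (dual M) F" "ground M \<inter> \<Inter>\<H> = F"
    "\<forall>H \<in> \<H>. dualr.hyperplane H"
    using dualr.closed_eq_Int_hyperplanes[OF assms] rk_dual_ground by auto
  have sub: "H \<subseteq> ground M" if "H \<in> \<H>" for H
    using \<H>(4) that dualr.closed_subset unfolding dualr.hyperplane_def by auto
  show ?thesis
  proof (rule that)
    show "(\<lambda>H. ground M - H) ` \<H> \<subseteq> circuits M"
      using \<H>(4) sub circuits_iff_hyperplane by (auto simp: double_diff)
    have "inj_on (\<lambda>H. ground M - H) \<H>" using sub by (intro inj_onI) blast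
    then show "card ((\<lambda>H. ground M - H) ` \<H>) = 3 - rk (dual M) F"
      using \<H>(2) by (simp add: card_image)
    show "common ((\<lambda>H. ground M - H) ` \<H>) = F" using \<H>(3) by auto
  qed
qed

text \<open>For a flat \<open>F\<close> of the dual, \<open>F \<inter> C = {}\<close> says that the
  hyperplane \<open>ground M - C\<close> contains \<open>F\<close>. Smaller flats get larger images,
  matching the opposite order.\<close>

definition adj :: "'a set \<Rightarrow> 'a set set" where
  "adj F = {C \<in> circuits M. F \<inter> C = {}}"

lemma adj_subset: "adj F \<subseteq> circuits M"
  by (auto simp: adj_def)

text \<open>A flat is an intersection of hyperplanes, hence of all those containing it. So
  \<open>F\<close> is recovered from \<open>adj F\<close>, which makes \<open>adj\<close> reflect
  the order.\<close>

lemma common_adj: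
  assumes "dualr.closed F"
  shows "common (adj F) = F"
proof -
  obtain S where S: "S \<subseteq> circuits M" "common S = F" using flat_eq_common[OF assms] by blast
  then have "S \<subseteq> adj F" unfolding adj_def by auto
  then have "common (adj F) \<subseteq> F" using S by auto
  moreover have "F \<subseteq> common (adj F)"
    using dualr.closed_subset[OF assms] unfolding adj_def by auto
  ultimately show ?thesis by simp
qed

lemma rk_adj:
  assumes "dualr.closed F"
  shows "rk (derived_matroid M) (adj F) = 3 - rk (dual M) F"
proof (rule antisym)
  show "rk (derived_matroid M) (adj F) \<le> 3 - rk (dual M) F"
    using rk_derived_le[OF adj_subset, of F] common_adj[OF assms] by simp
  obtain S where S: "S \<subseteq> circuits M" "card S = 3 - rk (dual M) F" "common S = F"
    using flat_eq_common[OF assms] .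
  then have "S \<subseteq> adj F" unfolding adj_def by auto
  moreover have "indep (derived_matroid M) S"
    using S by (simp add: indep_derived small_circuit_sets_iff)
  ultimately show "3 - rk (dual M) F \<le> rk (derived_matroid M) (adj F)"
    using derived.card_le_rk S(2) by metis
qed

lemma adj_flat:
  assumes F: "dualr.closed F"
  shows "adj F \<in> flats (derived_matroid M)"
proof -
  have "rk (derived_matroid M) (insert C (adj F)) \<noteq> rk (derived_matroid M) (adj F)"
    if C: "C \<in> circuits M" "C \<notin> adj F" for C
  proof -
    obtain S where S: "S \<subseteq> circuits M" "card S = 3 - rk (dual M) F" "common S = F"
      using flat_eq_common[OF F] .
    have SF: "S \<subseteq> adj F" using S unfolding adj_def by auto
    have finS: "finite S" using S finite_circuits finite_subset by blast
    have CS: "insert C S \<subseteq> circuits M" using C S by auto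
    \<comment> \<open>\<open>C \<notin> adj F\<close> means that the hyperplane of \<open>C\<close>
      does not contain \<open>F\<close>; the resulting drop in rank makes room for one more
      independent element.\<close>
    have "common (insert C S) \<subset> F" using S(3) C unfolding adj_def by auto
    then have "rk (dual M) (common (insert C S)) < rk (dual M) F"
      using closed_common[OF CS] dualr.closed_subset[OF F] by (intro dualr.rank_less_closed)
    \<comment> \<open>This keeps the subtraction from three from truncating, so a smaller rank
      really gives a larger bound on the size.\<close>
    moreover have "rk (dual M) F \<le> 3"
      using dualr.rank_mono[of F "ground M"] dualr.closed_subset[OF F] rk_dual_ground by simp
    moreover have card: "card (insert C S) = Suc (3 - rk (dual M) F)"
    proof -
      have "C \<notin> S" using SF C by blast
      then show ?thesis using finS S(2) by simp
    qed
    ultimately have "indep (derived_matroid M) (insert C S)"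
      using CS by (simp add: indep_derived small_circuit_sets_iff)
    then have "card (insert C S) \<le> rk (derived_matroid M) (insert C (adj F))"
      using SF by (intro derived.card_le_rk) auto
    then show ?thesis using card rk_adj[OF F] by simp
  qed
  then show ?thesis
    using adj_subset unfolding flats_def closure_def ground_derived
    by (auto simp: insert_absorb)
qed

lemma adj_compl: "C \<in> circuits M \<Longrightarrow> adj (ground M - C) = {C}"
  using circuit_subset_eq circuit_subset_ground unfolding adj_def by blast

text \<open>\<open>{C}\<close> is the image under \<open>adj\<close> of the hyperplane
  \<open>ground M - C\<close>, hence a flat.\<close>

lemma closure_derived_singleton:
  assumes "C \<in> circuits M"
  shows "closure (derived_matroid M) {C} = {C}"
  using adj_flat[of "ground M - C"] adj_compl[OF assms] hyperplane_compl[OF assms]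
  unfolding flats_def dualr.hyperplane_def by auto

lemma adj_subset_iff:
  assumes "dualr.closed F" "dualr.closed G"
  shows "adj F \<subseteq> adj G \<longleftrightarrow> G \<subseteq> F"
proof
  assume "adj F \<subseteq> adj G"
  then have "common (adj G) \<subseteq> common (adj F)" by auto
  then show "G \<subseteq> F" using assms common_adj by simp
qed (auto simp: adj_def)

section \<open>Atoms of the two lattices\<close>

lemma atoms_dual_flat_lattice_opp:
  "atoms (dual_flat_lattice_opp M) = (\<lambda>C. ground M - C) ` circuits M"
proof -
  let ?L = "dual_flat_lattice_opp M"
  have carr: "carrier ?L = {F. dualr.closed F}"
    by (auto simp: dual_flat_lattice_opp_def flat_lattice_def flats_dual_iff)
  have le: "le ?L x y \<longleftrightarrow> y \<subseteq> x" and lless: "x \<sqsubset>\<^bsub>?L\<^esub> y \<longleftrightarrow> y \<subset> x" for x y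
    by (auto simp: dual_flat_lattice_opp_def flat_lattice_def lless_def)
  \<comment> \<open>In the reversed order the least flat is the ground set, so atoms are the maximal
    proper flats.\<close>
  have "bottom ?L = ground M"
    by (rule bottom_eqI) (auto simp: le carr dualr.closed_ground dualr.closed_subset[THEN subsetD])
  then have atoms: "H \<in> atoms ?L \<longleftrightarrow> dualr.closed H \<and> H \<subset> ground M \<and>
      \<not> (\<exists>F. dualr.closed F \<and> F \<subset> ground M \<and> H \<subset> F)" for H
    unfolding atoms_def by (auto simp: carr lless)
  show ?thesis
  proof (intro equalityI subsetI)
    fix H assume "H \<in> atoms ?L"
    then have H: "dualr.closed H" "H \<subset> ground M"
      and max: "\<And>F. dualr.closed F \<Longrightarrow> F \<subset> ground M \<Longrightarrow> \<not> H \<subset> F"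
      using atoms by auto
    obtain e where e: "e \<in> ground M - H" using H(2) by auto
    obtain H' where H': "dualr.hyperplane H'" "H \<subseteq> H'" "e \<notin> H'"
      using dualr.hyperplane_avoiding[OF H(1) e] .
    then have cl: "dualr.closed H'" "H' \<subseteq> ground M"
      using dualr.closed_subset unfolding dualr.hyperplane_def by auto
    then have "H = H'" using max[of H'] H'(2,3) e by blast
    then have "ground M - H \<in> circuits M" "ground M - (ground M - H) = H"
      using H'(1) cl circuits_iff_hyperplane[of "ground M - H"] by (auto simp: double_diff)
    then show "H \<in> (\<lambda>C. ground M - C) ` circuits M" by (metis imageI)
  next
    fix H assume "H \<in> (\<lambda>C. ground M - C) ` circuits M"
    then have H: "dualr.closed H" "Suc (rk (dual M) H) = rk (dual M) (ground M)"
      using hyperplane_compl unfolding dualr.hyperplane_def by auto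
    then have "H \<noteq> ground M" by auto
    \<comment> \<open>The rank would rise strictly twice from \<open>H\<close> to the ground set,
      but \<open>H\<close> has corank one.\<close>
    moreover have "\<not> (dualr.closed F \<and> F \<subset> ground M \<and> H \<subset> F)" for F
      using dualr.rank_less_closed[OF H(1), of F] dualr.rank_less_closed[of F "ground M"] H(2)
      by fastforce
    ultimately show "H \<in> atoms ?L"
      using H(1) dualr.closed_subset unfolding atoms by blast
  qed
qed

lemma atoms_flat_lattice_derived:
  "atoms (flat_lattice (derived_matroid M)) = (\<lambda>C. {C}) ` circuits M"
proof -
  let ?L = "flat_lattice (derived_matroid M)"
  have carr: "carrier ?L = flats (derived_matroid M)" by (simp add: flat_lattice_def)
  have le: "le ?L x y \<longleftrightarrow> x \<subseteq> y" and lless: "x \<sqsubset>\<^bsub>?L\<^esub> y \<longleftrightarrow> x \<subset> y" for x y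
    by (auto simp: flat_lattice_def lless_def)
  \<comment> \<open>No hyperplane contains the whole ground set, so its image under
    \<open>adj\<close> is empty; thus the empty set is a flat and the bottom element.\<close>
  have "ground M \<inter> C \<noteq> {}" if "C \<in> circuits M" for C
    using circuit_subset_ground[OF that] that indep_empty unfolding circuits_def
    by (metis (lifting) Int_absorb1 mem_Collect_eq)
  then have "adj (ground M) = {}" unfolding adj_def by blast
  then have empty: "{} \<in> flats (derived_matroid M)"
    using adj_flat[OF dualr.closed_ground] by simp
  then have "bottom ?L = {}"
    by (intro bottom_eqI) (auto simp: le carr)
  then have atoms: "A \<in> atoms ?L \<longleftrightarrow> A \<in> flats (derived_matroid M) \<and> A \<noteq> {} \<and>
      \<not> (\<exists>F \<in> flats (derived_matroid M). F \<noteq> {} \<and> F \<subset> A)" for A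
    unfolding atoms_def by (auto simp: carr lless)
  have single: "{C} \<in> flats (derived_matroid M)" if "C \<in> circuits M" for C
    using closure_derived_singleton[OF that] that by (simp add: flats_def ground_derived)
  show ?thesis
  proof (intro equalityI subsetI)
    fix A assume A: "A \<in> atoms ?L"
    then obtain C where C: "C \<in> A" using atoms by auto
    have "A \<subseteq> circuits M" using A atoms by (auto simp: flats_def ground_derived)
    then have "C \<in> circuits M" using C by auto
    then have "A = {C}" using A single[of C] C unfolding atoms by blast
    then show "A \<in> (\<lambda>C. {C}) ` circuits M" using \<open>C \<in> circuits M\<close> by auto
  next
    fix A assume "A \<in> (\<lambda>C. {C}) ` circuits M"
    then show "A \<in> atoms ?L" using single unfolding atoms by blast
  qed
qed

lemma is_adjoint_derived: "is_adjoint M (derived_matroid M)"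
proof -
  let ?L = "dual_flat_lattice_opp M" and ?N = "derived_matroid M"
  have carr: "carrier ?L = {F. dualr.closed F}"
    by (auto simp: dual_flat_lattice_opp_def flat_lattice_def flats_dual_iff)
  have compl: "closure ?N {ground M - (ground M - C)} = {C}" if "C \<in> circuits M" for C
    using closure_derived_singleton[OF that] circuit_subset_ground[OF that]
    by (simp add: double_diff)
  have "bij_betw (\<lambda>H. closure ?N {ground M - H}) (atoms ?L) (atoms (flat_lattice ?N))"
    unfolding bij_betw_def
  proof
    show "inj_on (\<lambda>H. closure ?N {ground M - H}) (atoms ?L)"
      unfolding atoms_dual_flat_lattice_opp using compl by (auto simp: inj_on_def)
    show "(\<lambda>H. closure ?N {ground M - H}) ` atoms ?L = atoms (flat_lattice ?N)"
      unfolding atoms_dual_flat_lattice_opp atoms_flat_lattice_derived image_image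
      using compl by (intro image_cong) auto
  qed
  \<comment> \<open>From here on \<open>adj\<close> serves as the embedding demanded by
    \<open>is_adjoint\<close>.\<close>
  moreover have "\<forall>H \<in> atoms ?L. adj H = closure ?N {ground M - H}"
    unfolding atoms_dual_flat_lattice_opp using compl adj_compl by auto
  moreover have "adj \<in> carrier ?L \<rightarrow> carrier (flat_lattice ?N)"
    unfolding carr by (simp add: flat_lattice_def adj_flat)
  moreover have "\<forall>x \<in> carrier ?L. \<forall>y \<in> carrier ?L.
      le ?L x y \<longleftrightarrow> le (flat_lattice ?N) (adj x) (adj y)"
    unfolding carr by (simp add: dual_flat_lattice_opp_def flat_lattice_def adj_subset_iff)
  moreover have "\<forall>x \<in> carrier ?L.
      rk ?N (adj x) = (card (ground M) - rk M (ground M)) - rk (dual M) x"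
    unfolding carr corank rk_dual_ground by (simp add: rk_adj)
  ultimately show ?thesis
    unfolding is_adjoint_def using matroid_derived ground_derived by blast
qed

end

theorem theorem6p4:
  fixes M :: "'a matroid"
  assumes "matroid M"
    and "rk (dual M) (ground (dual M)) = 3"
  shows "is_adjoint M (derived_matroid M)"
proof -
  interpret matroid M by (rule assms(1))
  interpret corank_three M
    using assms(2) by unfold_locales (simp add: dual_def)
  show ?thesis by (rule is_adjoint_derived)
qed

end
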